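(* Let $G$ be a resistance regular graph. Then $G$ has no cut vertex.
   Context: All graphs are finite, simple, undirected and connected. A cut vertex of a connected graph $G$ is a vertex whose deletion disconnects $G$. The resistance distance $r_{ij}$ is the effective resistance between vertices $i$ and $j$ when each edge of $G$ carries a unit resistance; equivalently (known fact) $r_{ij}=L_{ii}^++L_{jj}^+-2L_{ij}^+$, where $L^+$ is the Moore-Penrose inverse of the Laplacian matrix $L=D-A$ of $G$. The resistance matrix is $R(G)=(r_{ij})$. A connected graph $G$ is resistance regular if all row sums of $R(G)$ are equal. *)

theory Defs
  imports Complex_Main "Graph_Theory.Graph_Theory"
begin

text \<open>
  Finite simple undirected graphs are the symmetric, loop-free digraphs without parallel arcs of
  the locale \<^locale>\<open>graph\<close>: an undirected edge \<open>uv\<close> is the pair of arcs \<open>(u, v)\<close>, \<open>(v, u)\<close>.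
  The name \<open>connected\<close> also denotes topological connectedness, so it is written qualified.
\<close>

text \<open>
  Since \<^const>\<open>Digraph_Component.connected\<close> is false for the empty graph, the remaining vertex set
  is required to be nonempty; otherwise the vertex of the one-vertex graph would be a cut vertex.
\<close>

definition cut_vertex :: "('a, 'b) pre_digraph \<Rightarrow> 'a \<Rightarrow> bool" where
  "cut_vertex G v \<longleftrightarrow>
     v \<in> verts G \<and> verts (pre_digraph.del_vert G v) \<noteq> {} \<and>
     \<not> Digraph_Component.connected (pre_digraph.del_vert G v)"

text \<open>
  With a unit resistor on every edge, Ohm's law gives the current \<open>p x - p y\<close> from \<open>x\<close> to a
  neighbour \<open>y\<close>. Kirchhoff's current law then says that the net current out of \<open>x\<close> equals the
  current fed in from outside: \<open>1\<close> at \<open>i\<close>, \<open>-1\<close> at \<open>j\<close>, \<open>0\<close> elsewhere (and \<open>0\<close> everywhere if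
  \<open>i = j\<close>). The values of \<open>p\<close> outside the vertex set are irrelevant.
\<close>

definition unit_current_potential ::
    "('a, 'b) pre_digraph \<Rightarrow> 'a \<Rightarrow> 'a \<Rightarrow> ('a \<Rightarrow> real) \<Rightarrow> bool" where
  "unit_current_potential G i j p \<longleftrightarrow>
     (\<forall>x \<in> verts G. (\<Sum>y \<in> {y \<in> verts G. x \<rightarrow>\<^bsub>G\<^esub> y}. p x - p y) =
        (if x = i then 1 else 0) - (if x = j then 1 else 0))"

text \<open>
  The effective resistance between \<open>i\<close> and \<open>j\<close> is the voltage between them under a unit current
  from \<open>i\<close> to \<open>j\<close>. In a connected graph such a potential exists and is unique up to an additive
  constant, so the description is well defined for vertices \<open>i\<close>, \<open>j\<close>.
\<close>

definition resistance_distance :: "('a, 'b) pre_digraph \<Rightarrow> 'a \<Rightarrow> 'a \<Rightarrow> real" where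
  "resistance_distance G i j =
     (THE r. \<exists>p. unit_current_potential G i j p \<and> r = p i - p j)"

definition resistance_regular :: "('a, 'b) pre_digraph \<Rightarrow> bool" where
  "resistance_regular G \<longleftrightarrow>
     Digraph_Component.connected G \<and>
     (\<exists>c. \<forall>i \<in> verts G. (\<Sum>j \<in> verts G. resistance_distance G i j) = c)"

end

theory Submission
  imports Defs
begin

text \<open>
  Suppose that \<open>v\<close> separates the remaining vertices into nonempty parts \<open>A\<close> and \<open>B\<close>.
  A unit current from \<open>a \<in> A\<close> to \<open>v\<close> leaves \<open>B\<close> at the potential of \<open>v\<close> by the maximum principle,
  so superposition gives \<open>r a b = r a v + r v b\<close> for \<open>b \<in> B\<close>. If all row sums agree, comparing
  the row of \<open>v\<close> with the row of \<open>a\<close> yields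
  \<open>(\<Sum>j\<in>A. r v j) = (\<Sum>j\<in>A. r a j) + (|B| + 1) * r a v\<close>. Summing over \<open>a \<in> A\<close>, the positive
  number \<open>\<Sum>j\<in>A. r v j\<close> times \<open>|A| - |B| - 1\<close> is a sum of resistances, hence nonnegative, so
  \<open>|B| < |A|\<close>. By symmetry \<open>|A| < |B|\<close>, which is absurd.
\<close>

section \<open>Underdetermined homogeneous systems\<close>

text \<open>Gaussian elimination, by induction on the equations: one with a nonzero coefficient at
  \<open>x0\<close> serves to eliminate \<open>x0\<close> from the others. This later supplies the
  potentials.\<close>

lemma underdetermined_homogeneous_system:
  fixes a :: "'e \<Rightarrow> 'x \<Rightarrow> 'k::field"
  assumes "finite E" "finite X" "card E < card X"
  shows "\<exists>p. (\<exists>x\<in>X. p x \<noteq> 0) \<and> (\<forall>e\<in>E. (\<Sum>x\<in>X. a e x * p x) = 0)"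
  using assms
proof (induction E arbitrary: X a rule: finite_induct)
  case empty
  then have "X \<noteq> {}" by auto
  then show ?case by (intro exI[of _ "\<lambda>_. 1"]) auto
next
  case (insert e E)
  show ?case
  proof (cases "\<forall>x\<in>X. a e x = 0")
    case True
    have "card E < card X" using insert by simp
    from insert.IH[OF insert.prems(1) this, of a] obtain p
      where "\<exists>x\<in>X. p x \<noteq> 0" "\<forall>e\<in>E. (\<Sum>x\<in>X. a e x * p x) = 0" by blast
    with True show ?thesis by (intro exI[of _ p]) auto
  next
    case False
    then obtain x0 where x0: "x0 \<in> X" "a e x0 \<noteq> 0" by blast
    let ?X = "X - {x0}"
    \<comment> \<open>The row of \<open>f\<close> minus the multiple of the row of \<open>e\<close>
      that clears the coefficient at \<open>x0\<close>.\<close>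
    define a' where "a' f x = a f x - a f x0 * a e x / a e x0" for f x
    have "card E < card ?X" using insert x0 by simp
    from insert.IH[OF _ this, of a'] insert.prems obtain p
      where p: "\<exists>x\<in>?X. p x \<noteq> 0" "\<forall>f\<in>E. (\<Sum>x\<in>?X. a' f x * p x) = 0" by auto
    define s where "s f = (\<Sum>x\<in>?X. a f x * p x)" for f
    \<comment> \<open>The value at \<open>x0\<close> is the one that equation \<open>e\<close>
      forces.\<close>
    define q where "q = p(x0 := - s e / a e x0)"
    have sum_q: "(\<Sum>x\<in>X. a f x * q x) = s f - a f x0 * s e / a e x0" for f
    proof -
      have "(\<Sum>x\<in>X. a f x * q x) = a f x0 * q x0 + (\<Sum>x\<in>?X. a f x * q x)"
        using insert.prems x0 by (simp add: sum.remove)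
      also have "(\<Sum>x\<in>?X. a f x * q x) = s f"
        unfolding s_def q_def by (intro sum.cong) auto
      finally show ?thesis by (simp add: q_def)
    qed
    have "(\<Sum>x\<in>?X. a' f x * p x) = s f - a f x0 * s e / a e x0" for f
      by (simp add: a'_def s_def left_diff_distrib sum_subtractf sum_distrib_left
          sum_divide_distrib mult.assoc)
    then have "\<forall>f\<in>insert e E. (\<Sum>x\<in>X. a f x * q x) = 0"
      using p(2) x0 by (auto simp: sum_q)
    moreover have "\<exists>x\<in>X. q x \<noteq> 0" using p(1) by (auto simp: q_def)
    ultimately show ?thesis by blast
  qed
qed

section \<open>Harmonic functions on a connected graph\<close>

text \<open>This is the graph Laplacian applied to \<open>f\<close>; \<open>f\<close> is harmonic at
  \<open>x\<close> when the value is zero.\<close>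

definition net_outflow :: "('a, 'b) pre_digraph \<Rightarrow> ('a \<Rightarrow> real) \<Rightarrow> 'a \<Rightarrow> real" where
  "net_outflow G f x = (\<Sum>y \<in> {y \<in> verts G. x \<rightarrow>\<^bsub>G\<^esub> y}. f x - f y)"

lemma net_outflow_add: "net_outflow G (\<lambda>x. f x + g x) x = net_outflow G f x + net_outflow G g x"
  unfolding net_outflow_def by (simp flip: sum.distrib add: algebra_simps)

lemma net_outflow_diff: "net_outflow G (\<lambda>x. f x - g x) x = net_outflow G f x - net_outflow G g x"
  unfolding net_outflow_def by (simp flip: sum_subtractf add: algebra_simps)

lemma net_outflow_uminus: "net_outflow G (\<lambda>x. - f x) x = - net_outflow G f x"
  unfolding net_outflow_def by (simp flip: sum_negf)

lemma net_outflow_divide: "net_outflow G (\<lambda>x. f x / t) x = net_outflow G f x / t"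
  unfolding net_outflow_def by (simp add: sum_divide_distrib diff_divide_distrib)

lemma unit_current_potential_iff:
  "unit_current_potential G i j p \<longleftrightarrow>
     (\<forall>x \<in> verts G. net_outflow G p x = (if x = i then 1 else 0) - (if x = j then 1 else 0))"
  unfolding unit_current_potential_def net_outflow_def ..

lemma unit_current_potential_uminus:
  "unit_current_potential G i j p \<Longrightarrow> unit_current_potential G j i (\<lambda>x. - p x)"
  by (simp add: unit_current_potential_iff net_outflow_uminus)

lemma unit_current_potential_add:
  assumes "unit_current_potential G i v p" "unit_current_potential G v j q"
  shows "unit_current_potential G i j (\<lambda>x. p x + q x)"
  using assms by (simp add: unit_current_potential_iff net_outflow_add)

section \<open>Separations and cut vertices\<close>

definition separation :: "('a, 'b) pre_digraph \<Rightarrow> 'a \<Rightarrow> 'a set \<Rightarrow> 'a set \<Rightarrow> bool" where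
  "separation G v A B \<longleftrightarrow>
     verts G = insert v (A \<union> B) \<and> A \<noteq> {} \<and> B \<noteq> {} \<and> A \<inter> B = {} \<and> v \<notin> A \<and> v \<notin> B \<and>
     (\<forall>x\<in>A. \<forall>y\<in>B. \<not> x \<rightarrow>\<^bsub>G\<^esub> y \<and> \<not> y \<rightarrow>\<^bsub>G\<^esub> x)"

lemma separation_commute: "separation G v A B \<Longrightarrow> separation G v B A"
  unfolding separation_def by blast

context graph
begin

text \<open>The two arcs of an edge contribute opposite differences, so the double sum equals its
  own negative.\<close>

lemma sum_net_outflow: "(\<Sum>x\<in>verts G. net_outflow G f x) = 0"
proof -
  let ?d = "\<lambda>x y. if x \<rightarrow> y then f x - f y else 0"
  have eq: "(\<Sum>x\<in>verts G. net_outflow G f x) = (\<Sum>x\<in>verts G. \<Sum>y\<in>verts G. ?d x y)"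
    unfolding net_outflow_def by (intro sum.cong sum.inter_filter) auto
  also have "\<dots> = (\<Sum>x\<in>verts G. \<Sum>y\<in>verts G. ?d y x)" by (rule sum.swap)
  also have "\<dots> = - (\<Sum>x\<in>verts G. \<Sum>y\<in>verts G. ?d x y)"
    unfolding sum_negf[symmetric] by (intro sum.cong) (auto dest: graph_symmetric)
  finally show ?thesis using eq by linarith
qed

text \<open>Some \<open>u\<close> fails to reach some \<open>w\<close> once \<open>v\<close> is
  deleted; \<open>A\<close> collects all that \<open>u\<close> still reaches, and \<open>B\<close>
  the rest.\<close>

lemma cut_vertex_separation:
  assumes "cut_vertex G v"
  obtains A B where "separation G v A B"
proof -
  interpret H: wf_digraph "del_vert v" by (rule wf_digraph_del_vert)
  have v: "v \<in> verts G" and ne: "verts (del_vert v) \<noteq> {}"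
    and nc: "\<not> Digraph_Component.connected (del_vert v)"
    using assms by (auto simp: cut_vertex_def)
  have adj: "x \<rightarrow>\<^bsub>del_vert v\<^esub> y \<longleftrightarrow> x \<rightarrow> y \<and> x \<noteq> v \<and> y \<noteq> v" for x y
    by (auto simp: arcs_ends_conv del_vert_simps)
  \<comment> \<open>\<open>connected\<close> means strong connectivity of the symmetric closure, and
    every path of \<open>del_vert v\<close> survives there.\<close>
  have "\<not> strongly_connected (del_vert v)"
  proof
    assume "strongly_connected (del_vert v)"
    then have "strongly_connected (mk_symmetric (del_vert v))"
      by (auto simp: strongly_connected_def intro: H.reachable_mk_symmetricI)
    then show False using nc by (simp add: Digraph_Component.connected_def)
  qed
  then obtain u w where uw: "u \<in> verts G - {v}" "w \<in> verts G - {v}"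
      "\<not> u \<rightarrow>\<^sup>*\<^bsub>del_vert v\<^esub> w"
    using ne by (auto simp: strongly_connected_def del_vert_simps)
  define A where "A = {x. u \<rightarrow>\<^sup>*\<^bsub>del_vert v\<^esub> x}"
  define B where "B = verts G - {v} - A"
  have A: "A \<subseteq> verts G - {v}"
    using H.reachable_in_verts unfolding A_def by (auto simp: del_vert_simps)
  have "u \<in> A" using uw unfolding A_def by (simp add: del_vert_simps)
  moreover have "w \<in> B" using uw unfolding A_def B_def by simp
  moreover have closed: "\<not> x \<rightarrow> y" if "x \<in> A" "y \<in> B" for x y
  proof
    assume "x \<rightarrow> y"
    then have "x \<rightarrow>\<^bsub>del_vert v\<^esub> y" using that A by (auto simp: adj B_def)
    then have "y \<in> A" using that H.reachable_adj_trans by (auto simp: A_def)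
    then show False using that by (simp add: B_def)
  qed
  moreover have "\<not> y \<rightarrow> x" if "x \<in> A" "y \<in> B" for x y
    using closed[OF that] graph_symmetric by blast
  ultimately have "separation G v A B"
    using A v unfolding separation_def B_def by blast
  then show ?thesis ..
qed

end

section \<open>The maximum principle and its consequences\<close>

locale connected_graph = graph +
  assumes connected: "Digraph_Component.connected G"
begin

lemma reachable_verts: "x \<in> verts G \<Longrightarrow> y \<in> verts G \<Longrightarrow> x \<rightarrow>\<^sup>* y"
  using symmetric_connected_imp_strongly_connected[OF sym_arcs connected] by auto

text \<open>Where the maximum is attained away from \<open>v\<close>, the outflow is a sum of
  nonnegative terms that is at most 0, so all neighbours attain the maximum too. Along a walk it
  spreads to \<open>v\<close>.\<close>

lemma maximum_principle:
  assumes v: "v \<in> verts G"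
    and sub: "\<And>x. x \<in> verts G \<Longrightarrow> x \<noteq> v \<Longrightarrow> net_outflow G f x \<le> 0"
    and x: "x \<in> verts G"
  shows "f x \<le> f v"
proof -
  define M where "M = Max (f ` verts G)"
  have le: "f y \<le> M" if "y \<in> verts G" for y
    using that unfolding M_def by simp
  have "M \<in> f ` verts G" unfolding M_def using v by (intro Max_in) auto
  then obtain m where m: "m \<in> verts G" "f m = M" by auto
  have "f v = M"
  proof (rule ccontr)
    assume nv: "f v \<noteq> M"
    have "f y = M" if "m \<rightarrow>\<^sup>* y" for y
      using that
    proof (induction rule: reachable_induct)
      case base
      show ?case by (rule m)
    next
      case (step x y)
      let ?N = "{y \<in> verts G. x \<rightarrow> y}"
      have xy: "x \<in> verts G" "y \<in> ?N" using step adj_in_verts by auto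
      have "net_outflow G f x \<le> 0" using step nv xy by (intro sub) auto
      moreover have nonneg: "\<forall>z\<in>?N. 0 \<le> f x - f z" using le step by auto
      ultimately have "(\<Sum>z\<in>?N. f x - f z) = 0"
        unfolding net_outflow_def by (intro antisym sum_nonneg) auto
      then have "f x - f y = 0" using nonneg xy by (subst (asm) sum_nonneg_eq_0_iff) auto
      then show ?case using step by simp
    qed
    then show False using nv reachable_verts[OF m(1) v] by blast
  qed
  then show ?thesis using le x by simp
qed

text \<open>The maximum principle applies to both \<open>f\<close> and \<open>- f\<close>.\<close>

lemma harmonic_constant:
  assumes v: "v \<in> verts G"
    and harm: "\<And>x. x \<in> verts G \<Longrightarrow> x \<noteq> v \<Longrightarrow> net_outflow G f x = 0"
    and x: "x \<in> verts G"
  shows "f x = f v"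
proof (rule antisym)
  show "f x \<le> f v" using harm by (intro maximum_principle[OF v _ x]) simp
  have "- f x \<le> - f v"
    using harm by (intro maximum_principle[OF v _ x]) (simp add: net_outflow_uminus)
  then show "f v \<le> f x" by simp
qed

lemma harmonic_constant_on_part:
  assumes sep: "separation G v A B"
    and harm: "\<And>x. x \<in> B \<Longrightarrow> net_outflow G f x = 0"
    and x: "x \<in> B"
  shows "f x = f v"
proof -
  \<comment> \<open>Flattening \<open>f\<close> outside \<open>B\<close> keeps the outflow on
    \<open>B\<close>, whose neighbours lie in \<open>B\<close> or are \<open>v\<close>, and makes it
    zero on \<open>A\<close>. So \<open>g\<close> is harmonic off \<open>v\<close>.\<close>
  define g where "g y = (if y \<in> B then f y else f v)" for y
  have "net_outflow G g y = 0" if y: "y \<in> verts G" "y \<noteq> v" for y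
  proof (cases "y \<in> B")
    case True
    then have "net_outflow G g y = net_outflow G f y"
      using sep unfolding net_outflow_def by (intro sum.cong) (auto simp: g_def separation_def)
    then show ?thesis using harm True by simp
  next
    case False
    then show ?thesis
      using sep y unfolding net_outflow_def
      by (intro sum.neutral) (auto simp: g_def separation_def)
  qed
  then have "g x = g v"
    using sep x by (intro harmonic_constant) (auto simp: separation_def)
  then show ?thesis using sep x by (simp add: g_def separation_def)
qed

section \<open>Resistance distance\<close>

text \<open>Kirchhoff's law at the vertices other than \<open>j\<close> gives one equation fewer
  than there are unknowns; a nontrivial solution, divided by \<open>t\<close>, is the
  potential.\<close>

lemma unit_current_potential_exists:
  assumes i: "i \<in> verts G" and j: "j \<in> verts G"
  shows "\<exists>p. unit_current_potential G i j p"
proof -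
  define b :: "'a \<Rightarrow> real" where "b x = (if x = i then 1 else 0) - (if x = j then 1 else 0)" for x
  \<comment> \<open>The unknowns are the potentials off \<open>j\<close>, where the potential is grounded, and a factor \<open>t\<close>
    (indexed by \<open>j\<close> itself) scaling the injected current.\<close>
  define N where "N x = {y \<in> verts G. x \<rightarrow> y}" for x
  define a :: "'a \<Rightarrow> 'a \<Rightarrow> real" where
    "a e x = (if x = j then - b e
       else (if x = e then real (card (N e)) else 0) - (if x \<in> N e then 1 else 0))" for e x
  have "card (verts G - {j}) < card (verts G)"
    using j by (intro card_Diff1_less) auto
  then obtain q where q: "\<exists>x\<in>verts G. q x \<noteq> 0"
      "\<forall>e\<in>verts G - {j}. (\<Sum>x\<in>verts G. a e x * q x) = 0"
    using underdetermined_homogeneous_system[of "verts G - {j}" "verts G" a] by auto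
  define t where "t = q j"
  define f where "f = q(j := 0)"
  have off: "net_outflow G f e = t * b e" if e: "e \<in> verts G" "e \<noteq> j" for e
  proof -
    let ?V = "verts G - {j}"
    have "net_outflow G f e = real (card (N e)) * f e - (\<Sum>y\<in>N e. f y)"
      unfolding net_outflow_def N_def by (simp add: sum_subtractf)
    also have "(\<Sum>y\<in>N e. f y) = (\<Sum>y\<in>N e - {j}. q y)"
      unfolding f_def N_def by (rule sum.mono_neutral_cong_right) auto
    also have "\<dots> = (\<Sum>x\<in>?V. if x \<in> N e then q x else 0)"
      by (simp add: sum.inter_restrict[symmetric]) (intro sum.cong, auto simp: N_def)
    also have "real (card (N e)) * f e = (\<Sum>x\<in>?V. if x = e then real (card (N e)) * q x else 0)"
      using e by (simp add: f_def)
    also have "\<dots> - (\<Sum>x\<in>?V. if x \<in> N e then q x else 0) = (\<Sum>x\<in>?V. a e x * q x)"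
      unfolding sum_subtractf[symmetric] by (intro sum.cong) (auto simp: a_def algebra_simps)
    also have "\<dots> = (\<Sum>x\<in>verts G. a e x * q x) - a e j * q j"
      using j by (simp add: sum_diff1)
    also have "\<dots> = t * b e" using q(2) e by (simp add: a_def t_def)
    finally show ?thesis .
  qed
  \<comment> \<open>The equation at \<open>j\<close> was not imposed; it follows since outflow and
    injected current both sum to zero.\<close>
  have flow: "net_outflow G f e = t * b e" if e: "e \<in> verts G" for e
  proof (cases "e = j")
    case True
    have "(\<Sum>x\<in>verts G. b x) = 0" using i j by (simp add: b_def sum_subtractf)
    then have "(\<Sum>x\<in>verts G. net_outflow G f x - t * b x) = 0"
      by (simp add: sum_subtractf sum_net_outflow flip: sum_distrib_left)
    also have "(\<Sum>x\<in>verts G. net_outflow G f x - t * b x) = net_outflow G f j - t * b j"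
      using off j by (subst sum.remove[of _ j]) auto
    finally show ?thesis using True by simp
  qed (use off e in blast)
  \<comment> \<open>Without injected current \<open>f\<close> is harmonic everywhere, hence equal to
    its grounded value 0, and the solution \<open>q\<close> would be trivial.\<close>
  have "t \<noteq> 0"
  proof
    assume "t = 0"
    have "f x = f j" if "x \<in> verts G" for x
      using flow \<open>t = 0\<close> that by (intro harmonic_constant[OF j]) auto
    then have "q x = 0" if "x \<in> verts G" for x
      using that \<open>t = 0\<close> unfolding f_def t_def by (metis fun_upd_def)
    then show False using q(1) by blast
  qed
  then have "unit_current_potential G i j (\<lambda>x. f x / t)"
    using flow by (simp add: unit_current_potential_iff net_outflow_divide b_def)
  then show ?thesis by blast
qed

text \<open>The difference of two such potentials is harmonic, hence constant; this justifies the
  definite description of the resistance.\<close>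

lemma unit_current_potential_unique:
  assumes i: "i \<in> verts G" and j: "j \<in> verts G"
    and "unit_current_potential G i j p" "unit_current_potential G i j q"
  shows "p i - p j = q i - q j"
proof -
  have "p i - q i = p j - q j"
    using assms
    by (intro harmonic_constant[where f = "\<lambda>x. p x - q x"])
      (auto simp: unit_current_potential_iff net_outflow_diff)
  then show ?thesis by simp
qed

lemma resistance_distance_eq:
  assumes "i \<in> verts G" "j \<in> verts G" "unit_current_potential G i j p"
  shows "resistance_distance G i j = p i - p j"
  unfolding resistance_distance_def
  using assms by (intro the_equality) (auto dest: unit_current_potential_unique)

lemma resistance_distance_commute:
  assumes "i \<in> verts G" "j \<in> verts G"
  shows "resistance_distance G i j = resistance_distance G j i"
proof -
  obtain p where p: "unit_current_potential G i j p"
    using unit_current_potential_exists assms by blast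
  show ?thesis
    using resistance_distance_eq[OF assms p]
      resistance_distance_eq[OF assms(2,1) unit_current_potential_uminus[OF p]] by simp
qed

lemma resistance_distance_self: "i \<in> verts G \<Longrightarrow> resistance_distance G i i = 0"
  using unit_current_potential_exists resistance_distance_eq by fastforce

text \<open>The potential is largest at the source and smallest at the sink; if these values agreed,
  it would be constant and no current would leave \<open>i\<close>.\<close>

lemma resistance_distance_pos:
  assumes i: "i \<in> verts G" and j: "j \<in> verts G" and "i \<noteq> j"
  shows "0 < resistance_distance G i j"
proof -
  obtain p where p: "unit_current_potential G i j p"
    using unit_current_potential_exists i j by blast
  have max: "p x \<le> p i" if "x \<in> verts G" for x
    using p by (intro maximum_principle[OF i _ that]) (auto simp: unit_current_potential_iff)
  have "- p x \<le> - p j" if "x \<in> verts G" for x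
    using p by (intro maximum_principle[OF j _ that])
      (auto simp: unit_current_potential_iff net_outflow_uminus)
  then have min: "p j \<le> p x" if "x \<in> verts G" for x using that by simp
  have "p i \<noteq> p j"
  proof
    assume "p i = p j"
    then have "net_outflow G p i = 0"
      using max min unfolding net_outflow_def by (intro sum.neutral) (auto intro: antisym)
    then show False using p i \<open>i \<noteq> j\<close> by (simp add: unit_current_potential_iff)
  qed
  then show ?thesis using max[OF j] resistance_distance_eq[OF i j p] by simp
qed

lemma resistance_distance_nonneg:
  assumes "i \<in> verts G" "j \<in> verts G"
  shows "0 \<le> resistance_distance G i j"
  using resistance_distance_pos[OF assms] resistance_distance_self[OF assms(1)] by force

section \<open>Resistances and row sums across a separation\<close>

lemma resistance_distance_separation:
  assumes sep: "separation G v A B" and i: "i \<in> A" and j: "j \<in> B"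
  shows "resistance_distance G i j = resistance_distance G i v + resistance_distance G v j"
proof -
  have V: "v \<in> verts G" "i \<in> verts G" "j \<in> verts G"
    using sep i j by (auto simp: separation_def)
  obtain p q where p: "unit_current_potential G i v p" and q: "unit_current_potential G v j q"
    using unit_current_potential_exists V by meson
  \<comment> \<open>The current of \<open>p\<close> has neither source nor sink in \<open>B\<close>,
    and that of \<open>q\<close> has none in \<open>A\<close>.\<close>
  have "p j = p v"
    using p sep i
    by (intro harmonic_constant_on_part[OF sep _ j])
      (auto simp: unit_current_potential_iff separation_def)
  moreover have "q i = q v"
    using q sep j
    by (intro harmonic_constant_on_part[OF separation_commute[OF sep] _ i])
      (auto simp: unit_current_potential_iff separation_def)
  ultimately show ?thesis
    using resistance_distance_eq[OF V(2,3) unit_current_potential_add[OF p q]]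
      resistance_distance_eq[OF V(2,1) p] resistance_distance_eq[OF V(1,3) q] by simp
qed

lemma separation_card_less:
  assumes sep: "separation G v A B"
    and reg: "\<And>i. i \<in> verts G \<Longrightarrow> (\<Sum>j\<in>verts G. resistance_distance G i j) = c"
  shows "card B < card A"
proof -
  let ?r = "resistance_distance G"
  have V: "verts G = insert v (A \<union> B)" "A \<noteq> {}" "A \<inter> B = {}" "v \<notin> A" "v \<notin> B"
    using sep by (auto simp: separation_def)
  have fin: "finite A" "finite B" using finite_verts unfolding V(1) by auto
  define T where "T = (\<Sum>j\<in>A. ?r v j)"
  have row: "?r i v + (\<Sum>j\<in>A. ?r i j) + (\<Sum>j\<in>B. ?r i j) = c" if "i \<in> verts G" for i
    using reg[OF that] V fin by (simp add: sum.union_disjoint)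
  \<comment> \<open>Subtracting the rows of \<open>i\<close> and \<open>v\<close> cancels the
    resistances from \<open>v\<close> to \<open>B\<close>. The extra 1 is the entry
    \<open>?r i v\<close>, whose counterpart \<open>?r v v\<close> is 0.\<close>
  have "T = (\<Sum>j\<in>A. ?r i j) + (card B + 1) * ?r v i" if i: "i \<in> A" for i
  proof -
    have "(\<Sum>j\<in>B. ?r i j) = (\<Sum>j\<in>B. ?r i v + ?r v j)"
      using resistance_distance_separation[OF sep i] by simp
    also have "\<dots> = card B * ?r i v + (\<Sum>j\<in>B. ?r v j)" by (simp add: sum.distrib)
    finally show ?thesis
      using row[of i] row[of v] i V resistance_distance_self[of v]
        resistance_distance_commute[of i v]
      by (simp add: T_def algebra_simps)
  qed
  then have "(\<Sum>i\<in>A. T) = (\<Sum>i\<in>A. (\<Sum>j\<in>A. ?r i j) + (card B + 1) * ?r v i)"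
    by (intro sum.cong) auto
  \<comment> \<open>Summed over \<open>i\<close> in \<open>A\<close>, the entries
    \<open>?r v i\<close> make up \<open>T\<close> again.\<close>
  then have "card A * T = (\<Sum>i\<in>A. \<Sum>j\<in>A. ?r i j) + (card B + 1) * T"
    by (simp only: sum.distrib sum_constant T_def sum_distrib_left[symmetric])
  moreover have "0 \<le> (\<Sum>i\<in>A. \<Sum>j\<in>A. ?r i j)"
    using V by (intro sum_nonneg resistance_distance_nonneg) auto
  ultimately have "real (card B + 1) * T \<le> real (card A) * T" by simp
  \<comment> \<open>Cancelling \<open>T\<close> leaves \<open>card B + 1\<close> at most
    \<open>card A\<close>, which is the strict inequality.\<close>
  moreover have "0 < T"
    unfolding T_def using V fin by (intro sum_pos resistance_distance_pos) auto
  ultimately show ?thesis by (simp add: mult_le_cancel_right)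
qed

end

theorem theorem2p13:
  fixes G :: "('a, 'b) pre_digraph"
  assumes "graph G"
    and "resistance_regular G"
  shows "\<not> (\<exists>v. cut_vertex G v)"
proof
  assume "\<exists>v. cut_vertex G v"
  then obtain v where v: "cut_vertex G v" ..
  interpret graph G by fact
  interpret connected_graph G
    using assms(2) by unfold_locales (simp add: resistance_regular_def)
  obtain c where c: "\<And>i. i \<in> verts G \<Longrightarrow> (\<Sum>j\<in>verts G. resistance_distance G i j) = c"
    using assms(2) unfolding resistance_regular_def by blast
  obtain A B where sep: "separation G v A B" using cut_vertex_separation[OF v] .
  show False
    using separation_card_less[OF sep c] separation_card_less[OF separation_commute[OF sep] c]
    by simp
qed

end
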